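(* Let $(X,d)$ be a compact ultrametric space and let $k$ be a positive integer. Then there exists a Lipschitz map from $X$ onto the cube $[0,1]^k$ if and only if $\mathcal{H}^k(X)>0$.
   Context: An ultrametric space is a metric space $(X,d)$ satisfying $d(x,y)\le\max(d(x,z),d(y,z))$ for all $x,y,z\in X$. $\mathcal{H}^k$ denotes the $k$-dimensional Hausdorff measure. *)

theory Defs
  imports "HOL-Analysis.Analysis"
begin

definition ultrametric_on :: "'a::metric_space set \<Rightarrow> bool" where
  "ultrametric_on X \<longleftrightarrow>
     (\<forall>x\<in>X. \<forall>y\<in>X. \<forall>z\<in>X. dist x y \<le> max (dist x z) (dist y z))"

definition hausdorff_content :: "real \<Rightarrow> real \<Rightarrow> 'a::metric_space set \<Rightarrow> ennreal" where
  "hausdorff_content s \<delta> A =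
     (INF C \<in> {C :: nat \<Rightarrow> 'a set. A \<subseteq> (\<Union>i. C i) \<and> (\<forall>i. bounded (C i) \<and> diameter (C i) \<le> \<delta>)}.
        (\<Sum>i. ennreal (diameter (C i) powr s)))"

definition hausdorff_measure :: "real \<Rightarrow> 'a::metric_space set \<Rightarrow> ennreal" where
  "hausdorff_measure s A = (SUP \<delta> \<in> {0<..}. hausdorff_content s \<delta> A)"

definition unit_cube :: "nat \<Rightarrow> (nat \<Rightarrow> real) set" where
  "unit_cube k = PiE {..<k} (\<lambda>_. {0..1})"

definition euclid_dist :: "nat \<Rightarrow> (nat \<Rightarrow> real) \<Rightarrow> (nat \<Rightarrow> real) \<Rightarrow> real" where
  "euclid_dist k u v = L2_set (\<lambda>i. u i - v i) {..<k}"

end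

theory Submission
  imports Defs "HOL-Complex_Analysis.Great_Picard"
begin

text \<open>
  A Lipschitz map of \<open>X\<close> onto the cube sends a cover of \<open>X\<close> to a cover of the cube by boxes of
  comparable size, so comparing volumes bounds the Hausdorff content of \<open>X\<close> from below.

  Conversely, fix a smallest scale \<open>\<delta>\<close>. In an ultrametric space the sets of diameter at most
  \<open>\<delta> * 3 ^ m\<close> form a tree, and going up this tree one enumerates the points of each ball by
  \<open>0, \<dots>, v - 1\<close>: concatenate the enumerations of the children and truncate at \<open>3 ^ (k * m)\<close>.
  Truncation makes the enumeration \<open>k\<close>-Hoelder, and \<open>v\<close> stays at least the cost of some cover
  (as in max-flow min-cut), hence is large if the Hausdorff measure is positive. Composing with a
  discrete Peano curve, which is \<open>1/k\<close>-Hoelder, gives uniformly Lipschitz maps onto ever finer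
  grids; a limit of a subsequence as \<open>\<delta>\<close> tends to 0 is onto the cube.
\<close>

section \<open>Lipschitz preimages of the cube\<close>

text \<open>The image of \<open>X \<inter> C i\<close> lies in a box of side
  \<open>2 * M * diameter (C i)\<close>, so countable subadditivity of Lebesgue measure bounds the
  sum of the \<open>diameter (C i) powr real k\<close> below by \<open>1 / (2 * M) ^ k\<close>,
  however large the sets are. The content at the single scale 1 then suffices.\<close>

lemma hausdorff_measure_pos_if_onto_cube:
  fixes X :: "'a::metric_space set" and f :: "'a \<Rightarrow> nat \<Rightarrow> real"
  assumes "k \<ge> 1"
    and lip: "\<And>x y. x \<in> X \<Longrightarrow> y \<in> X \<Longrightarrow> euclid_dist k (f x) (f y) \<le> L * dist x y"
    and onto: "f ` X = unit_cube k"
  shows "hausdorff_measure (real k) X > 0"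
proof -
  \<comment> \<open>Nothing fixes the sign of \<open>L\<close>; a positive constant allows division
    by \<open>(2 * M) ^ k\<close>.\<close>
  define M where "M = max L 1"
  have M: "M > 0" "L \<le> M" by (auto simp: M_def)
  interpret product_sigma_finite "\<lambda>_::nat. lborel :: real measure" ..
  let ?P = "PiM {..<k} (\<lambda>_. lborel :: real measure)"
  have vol: "emeasure ?P (PiE {..<k} (\<lambda>l. {c l - r..c l + r})) = ennreal ((2 * r) ^ k)"
    if "r \<ge> 0" for c r
    using that by (subst emeasure_PiM) (auto simp: prod_ennreal ennreal_power)
  have cube: "emeasure ?P (unit_cube k) = 1"
    unfolding unit_cube_def by (subst emeasure_PiM) auto
  have lower: "ennreal (1 / (2 * M) ^ k) \<le> (\<Sum>i. ennreal (diameter (C i) powr real k))"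
    if cov: "X \<subseteq> (\<Union>i. C i)" and bd: "\<And>i. bounded (C i)" for C :: "nat \<Rightarrow> 'a set"
  proof -
    \<comment> \<open>If \<open>C i\<close> misses \<open>X\<close>, the centre is arbitrary: the
      box then has to catch no image point, and its volume depends only on
      \<open>r i\<close>.\<close>
    define c where "c i = f (SOME x. x \<in> X \<inter> C i)" for i
    define r where "r i = M * diameter (C i)" for i
    define Q where "Q i = PiE {..<k} (\<lambda>l. {c i l - r i..c i l + r i})" for i
    have d0: "diameter (C i) \<ge> 0" for i using diameter_ge_0[OF bd] .
    then have r0: "r i \<ge> 0" for i using M by (simp add: r_def)
    have fQ: "f x \<in> Q i" if "x \<in> X" "x \<in> C i" for x i
    proof -
      define y where "y = (SOME x. x \<in> X \<inter> C i)"
      have y: "y \<in> X" "y \<in> C i" using someI[of "\<lambda>x. x \<in> X \<inter> C i" x] that by (auto simp: y_def)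
      have "\<bar>f x l - f y l\<bar> \<le> r i" if "l < k" for l
      proof -
        have "\<bar>f x l - f y l\<bar> \<le> euclid_dist k (f x) (f y)"
          unfolding euclid_dist_def
          using member_le_L2_set[of "{..<k}" l "\<lambda>i. \<bar>f x i - f y i\<bar>"] that by (simp add: L2_set_def)
        also have "\<dots> \<le> L * dist x y" using lip \<open>x \<in> X\<close> y by blast
        also have "\<dots> \<le> M * dist x y" using M by (intro mult_right_mono) auto
        also have "\<dots> \<le> r i" unfolding r_def
          using diameter_bounded_bound[OF bd \<open>x \<in> C i\<close> y(2)] M by (intro mult_left_mono) auto
        finally show ?thesis .
      qed
      moreover have "f x \<in> extensional {..<k}"
        using onto \<open>x \<in> X\<close> unfolding unit_cube_def by (auto simp: PiE_def)
      ultimately show ?thesis unfolding Q_def c_def y_def[symmetric] PiE_def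
        by (force simp: abs_le_iff)
    qed
    have sub: "unit_cube k \<subseteq> (\<Union>i. Q i)"
      unfolding onto[symmetric]
    proof (rule image_subsetI)
      fix x assume "x \<in> X"
      moreover from this obtain i where "x \<in> C i" using cov by auto
      ultimately show "f x \<in> (\<Union>i. Q i)" using fQ by blast
    qed
    have meas: "Q i \<in> sets ?P" for i unfolding Q_def by (intro sets_PiM_I_finite) auto
    have "1 \<le> emeasure ?P (\<Union>i. Q i)"
      unfolding cube[symmetric] by (intro emeasure_mono sub sets.countable_UN) (use meas in auto)
    also have "\<dots> \<le> (\<Sum>i. emeasure ?P (Q i))"
      by (intro emeasure_subadditive_countably) (use meas in auto)
    also have "\<dots> = (\<Sum>i. ennreal ((2 * M) ^ k) * ennreal (diameter (C i) powr real k))"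
    proof (intro suminf_cong)
      fix i
      \<comment> \<open>At diameter 0 this relies on \<open>k \<ge> 1\<close>:
        \<open>0 powr real k\<close> is always 0, while \<open>0 ^ 0 = 1\<close>.\<close>
      have "(2 * r i) ^ k = (2 * M) ^ k * diameter (C i) powr real k"
        using d0[of i] \<open>k \<ge> 1\<close>
        by (cases "diameter (C i) = 0") (auto simp: r_def power_mult_distrib powr_realpow)
      then show "emeasure ?P (Q i) = ennreal ((2 * M) ^ k) * ennreal (diameter (C i) powr real k)"
        unfolding Q_def vol[OF r0] using M by (simp only: ennreal_mult zero_le_power powr_ge_zero)
    qed
    also have "\<dots> = ennreal ((2 * M) ^ k) * (\<Sum>i. ennreal (diameter (C i) powr real k))"
      by simp
    finally have "ennreal (1 / (2 * M) ^ k) * 1 \<le> ennreal (1 / (2 * M) ^ k) *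
        (ennreal ((2 * M) ^ k) * (\<Sum>i. ennreal (diameter (C i) powr real k)))"
      by (intro mult_left_mono) auto
    also have "\<dots> = (\<Sum>i. ennreal (diameter (C i) powr real k))"
      using M by (simp add: mult.assoc[symmetric] ennreal_mult[symmetric])
    finally show ?thesis by simp
  qed
  have "0 < ennreal (1 / (2 * M) ^ k)" using M by simp
  also have "\<dots> \<le> hausdorff_content (real k) 1 X"
    unfolding hausdorff_content_def by (intro INF_greatest) (use lower in auto)
  also have "\<dots> \<le> hausdorff_measure (real k) X"
    unfolding hausdorff_measure_def by (intro SUP_upper) auto
  finally show ?thesis .
qed

section \<open>A discrete Peano curve\<close>

text \<open>
  Peano's construction in dimension \<open>k\<close>: of the \<open>q\<close> ternary digits of \<open>t\<close>, most significant first,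
  the digit at position \<open>i\<close> goes to the coordinate \<open>i mod k\<close>, and is replaced by its complement
  to 2 if the sum of the preceding digits that belong to other coordinates is odd.
\<close>

primrec peano_parity :: "nat \<Rightarrow> nat \<Rightarrow> nat \<Rightarrow> nat \<Rightarrow> nat" where
  "peano_parity k 0 t l = 0"
| "peano_parity k (Suc q) t l =
     peano_parity k q (t div 3) l + (if q mod k = l then 0 else t mod 3)"

primrec peano_coord :: "nat \<Rightarrow> nat \<Rightarrow> nat \<Rightarrow> nat \<Rightarrow> nat" where
  "peano_coord k 0 t l = 0"
| "peano_coord k (Suc q) t l =
     (if q mod k = l
      then 3 * peano_coord k q (t div 3) l +
           (if even (peano_parity k q (t div 3) l) then t mod 3 else 2 - t mod 3)
      else peano_coord k q (t div 3) l)"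

text \<open>The ternary length of coordinate \<open>l\<close> of the curve with \<open>q\<close>
  digits, so that this coordinate ranges below \<open>3 ^ peano_digits k q l\<close>.\<close>

primrec peano_digits :: "nat \<Rightarrow> nat \<Rightarrow> nat \<Rightarrow> nat" where
  "peano_digits k 0 l = 0"
| "peano_digits k (Suc q) l = peano_digits k q l + (if q mod k = l then 1 else 0)"

lemma peano_digits_mult:
  assumes "l < k"
  shows "peano_digits k (k * n) l = n"
proof (induction n)
  case (Suc n)
  \<comment> \<open>Each round of \<open>k\<close> positions serves every coordinate once,
    coordinate \<open>l\<close> at offset \<open>l\<close>.\<close>
  have "r \<le> k \<Longrightarrow> peano_digits k (k * n + r) l = n + (if l < r then 1 else 0)" for r
    by (induction r) (use Suc in auto)
  from this[of k] show ?case using assms by (simp add: add.commute)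
qed simp

lemma peano_digits_mono: "peano_digits k q l \<le> peano_digits k (q + r) l"
  by (induction r) auto

lemma peano_coord_less: "peano_coord k q t l < 3 ^ peano_digits k q l"
proof (induction q arbitrary: t)
  case (Suc q)
  show ?case using Suc[of "t div 3"] mod_less_divisor[of 3 t] by (auto simp del: mod_less_divisor)
qed simp

text \<open>Self-similarity of the curve: a digit of a coordinate depends only on the digits of
  \<open>t\<close> up to its own position, so cutting trailing digits of \<open>t\<close> cuts
  trailing digits of the coordinates.\<close>

lemma peano_coord_prefix:
  "peano_coord k (q + r) t l div 3 ^ (peano_digits k (q + r) l - peano_digits k q l)
     = peano_coord k q (t div 3 ^ r) l"
proof (induction r arbitrary: t)
  case (Suc r)
  have d: "(3 * x + (if b then t mod 3 else 2 - t mod 3)) div 3 = x" for x b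
    using mod_less_divisor[of 3 t] by (auto simp del: mod_less_divisor)
  show ?case
    using Suc[of "t div 3"] peano_digits_mono[of k q l r]
    by (simp add: Suc_diff_le div_mult2_eq d)
qed simp

text \<open>Continuity of the curve, strengthened to pass through the induction: one step of
  \<open>t\<close> moves exactly one coordinate \<open>i\<close> by one, upwards or downwards
  according to the parity at \<open>i\<close>, which it keeps, and flips the parity at all other
  coordinates.\<close>

lemma peano_adjacent:
  "Suc t < 3 ^ q \<Longrightarrow> \<exists>i. \<forall>l.
     if l = i then even (peano_parity k q (Suc t) l) = even (peano_parity k q t l) \<and>
       (if even (peano_parity k q t l)
        then peano_coord k q (Suc t) l = Suc (peano_coord k q t l)
        else peano_coord k q t l = Suc (peano_coord k q (Suc t) l))
     else peano_coord k q (Suc t) l = peano_coord k q t l \<and>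
       even (peano_parity k q (Suc t) l) \<noteq> even (peano_parity k q t l)"
proof (induction q arbitrary: t)
  case (Suc q)
  show ?case
  proof (cases "t mod 3 = 2")
    case False
    \<comment> \<open>No carry: only the last digit changes, so the coordinate that owns it
      moves.\<close>
    then have m: "t mod 3 = 0 \<or> t mod 3 = 1" by linarith
    then have "Suc t div 3 = t div 3" "Suc t mod 3 = Suc (t mod 3)" by presburger+
    then show ?thesis using m by (intro exI[of _ "q mod k"]) auto
  next
    case True
    \<comment> \<open>Carry: the last digit drops from 2 to 0, which preserves parities. If its
      owner is not \<open>i\<close>, the parity there flips, and complementing turns the drop into
      no change; if it is \<open>i\<close>, the drop joins a step of the prefix into a step by
      one.\<close>
    then have e: "Suc t div 3 = Suc (t div 3)" "Suc t mod 3 = 0" by presburger+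
    have "Suc (t div 3) < 3 ^ q" using Suc.prems e by (metis less_mult_imp_div_less power_Suc2)
    from Suc.IH[OF this] obtain i where i: "\<forall>l.
     if l = i then even (peano_parity k q (Suc (t div 3)) l) = even (peano_parity k q (t div 3) l) \<and>
       (if even (peano_parity k q (t div 3) l)
        then peano_coord k q (Suc (t div 3)) l = Suc (peano_coord k q (t div 3) l)
        else peano_coord k q (t div 3) l = Suc (peano_coord k q (Suc (t div 3)) l))
     else peano_coord k q (Suc (t div 3)) l = peano_coord k q (t div 3) l \<and>
       even (peano_parity k q (Suc (t div 3)) l) \<noteq> even (peano_parity k q (t div 3) l)" by blast
    show ?thesis
    proof (intro exI[of _ i] allI, goal_cases)
      case (1 l)
      show ?case using i[rule_format, of l] True by (auto simp: e split: if_splits)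
    qed
  qed
qed simp

lemma peano_coord_Suc:
  assumes "Suc t < 3 ^ q"
  shows "\<bar>real (peano_coord k q (Suc t) l) - real (peano_coord k q t l)\<bar> \<le> 1"
proof -
  obtain i where "\<forall>l.
     if l = i then even (peano_parity k q (Suc t) l) = even (peano_parity k q t l) \<and>
       (if even (peano_parity k q t l)
        then peano_coord k q (Suc t) l = Suc (peano_coord k q t l)
        else peano_coord k q t l = Suc (peano_coord k q (Suc t) l))
     else peano_coord k q (Suc t) l = peano_coord k q t l \<and>
       even (peano_parity k q (Suc t) l) \<noteq> even (peano_parity k q t l)"
    using peano_adjacent[OF assms, of k] by blast
  from this[rule_format, of l] show ?thesis by (auto split: if_splits)
qed

text \<open>The digits of \<open>t\<close> can be solved for from the most significant one on: the
  parity deciding on complementation is known by then, and complementation to 2 is its own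
  inverse.\<close>

lemma peano_coord_surj:
  assumes "\<And>l. l < k \<Longrightarrow> y l < 3 ^ peano_digits k q l"
  shows "\<exists>t < 3 ^ q. \<forall>l < k. peano_coord k q t l = y l"
  using assms
proof (induction q arbitrary: y)
  case (Suc q)
  let ?i = "q mod k"
  define y' where "y' = y(?i := y ?i div 3)"
  have "y' l < 3 ^ peano_digits k q l" if "l < k" for l
    using Suc.prems[OF that] unfolding y'_def
    by (auto simp: less_mult_imp_div_less mult.commute)
  then obtain t where t: "t < 3 ^ q" "\<forall>l<k. peano_coord k q t l = y' l"
    using Suc.IH by blast
  define a where "a = (if even (peano_parity k q t ?i) then y ?i mod 3 else 2 - y ?i mod 3)"
  have a: "a < 3" by (auto simp: a_def)
  have dm: "(3 * t + a) div 3 = t" "(3 * t + a) mod 3 = a" using a by auto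
  have "(if even (peano_parity k q t ?i) then a else 2 - a) = y ?i mod 3"
    using mod_less_divisor[of 3 "y ?i"] by (auto simp: a_def simp del: mod_less_divisor)
  then have "peano_coord k (Suc q) (3 * t + a) l = y l" if "l < k" for l
    using t(2)[rule_format, OF that] unfolding peano_coord.simps dm y'_def
    by (cases "?i = l") simp_all
  moreover have "3 * t + a < 3 ^ Suc q" using t(1) a by simp
  ultimately show ?case by blast
qed auto

text \<open>For parameters less than \<open>3 ^ (k * j)\<close> apart, cutting the last
  \<open>k * j\<close> digits leaves equal or adjacent prefixes. The coordinates without their last
  \<open>j\<close> digits then differ by at most 1, and those digits account for the factor 2. For
  \<open>j > n\<close> the range of the coordinates suffices.\<close>

lemma peano_coord_holder:
  assumes s: "s < 3 ^ (k * n)" and t: "t < 3 ^ (k * n)" and "l < k"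
    and st: "\<bar>real s - real t\<bar> < (3 ^ k) ^ j"
  shows "\<bar>real (peano_coord k (k * n) s l) - real (peano_coord k (k * n) t l)\<bar> \<le> 2 * 3 ^ j"
  using s t st
proof (induction s t rule: linorder_wlog)
  case (le s t)
  let ?x = "\<lambda>u. peano_coord k (k * n) u l"
  show ?case
  proof (cases "j \<le> n")
    case False
    then have "(3::real) ^ n \<le> 3 ^ j" by simp
    moreover have "real (?x u) < 3 ^ n" for u
      using peano_coord_less[of k "k * n" u l] peano_digits_mult[OF \<open>l < k\<close>, of n]
      by (metis of_nat_less_numeral_power_cancel_iff)
    ultimately show ?thesis
      using of_nat_0_le_iff[of "?x s", where ?'a = real] of_nat_0_le_iff[of "?x t", where ?'a = real]
      by (smt (verit))
  next
    case True
    define q where "q = k * (n - j)"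
    have kn: "k * n = q + k * j" using True by (simp add: q_def flip: distrib_left)
    let ?K = "3 ^ (k * j) :: nat"
    have "peano_digits k (k * n) l - peano_digits k q l = j"
      unfolding q_def peano_digits_mult[OF \<open>l < k\<close>] using True by simp
    then have pre: "?x u div 3 ^ j = peano_coord k q (u div ?K) l" for u
      using peano_coord_prefix[of k q "k * j" u l] unfolding kn[symmetric] by simp
    have "real t < real s + real ?K" using le by (simp add: power_mult)
    then have "t < s + ?K" by linarith
    then have "t div ?K \<le> (s + ?K) div ?K" by (intro div_le_mono) simp
    then have "t div ?K \<le> Suc (s div ?K)" by simp
    moreover have "s div ?K \<le> t div ?K" using le by (intro div_le_mono)
    ultimately consider "t div ?K = s div ?K" | "t div ?K = Suc (s div ?K)" by linarith
    then have "\<bar>real (?x t div 3 ^ j) - real (?x s div 3 ^ j)\<bar> \<le> 1"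
    proof cases
      case 2
      have "t div ?K < 3 ^ q" using le kn by (simp add: less_mult_imp_div_less power_add)
      then show ?thesis using peano_coord_Suc[of "s div ?K" q k l] by (simp add: pre 2)
    qed (simp add: pre)
    then have "?x t div 3 ^ j \<le> ?x s div 3 ^ j + 1" "?x s div 3 ^ j \<le> ?x t div 3 ^ j + 1"
      by linarith+
    then have a: "?x t div 3 ^ j * 3 ^ j \<le> (?x s div 3 ^ j + 1) * 3 ^ j"
         "?x s div 3 ^ j * 3 ^ j \<le> (?x t div 3 ^ j + 1) * 3 ^ j"
      by (intro mult_right_mono; simp)+
    have b: "?x u = ?x u div 3 ^ j * 3 ^ j + ?x u mod 3 ^ j" "?x u mod 3 ^ j < 3 ^ j" for u
      by (rule div_mult_mod_eq[symmetric]) simp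
    have "?x t \<le> ?x s + 2 * 3 ^ j" "?x s \<le> ?x t + 2 * 3 ^ j"
      using a b[of s] b[of t] unfolding distrib_right by linarith+
    then have "real (?x t) \<le> real (?x s + 2 * 3 ^ j)" "real (?x s) \<le> real (?x t + 2 * 3 ^ j)"
      by (simp_all only: of_nat_le_iff)
    then show ?thesis by simp
  qed
next
  case (sym s t)
  then show ?case by (simp add: abs_minus_commute)
qed

section \<open>Hoelder enumerations of ultrametric spaces\<close>

text \<open>
  The number \<open>v\<close> bounds the cost of a cover in which a set of diameter at most \<open>\<delta> * 3 ^ m\<close>
  costs \<open>K ^ m\<close>; for \<open>K = 3 ^ k\<close> this is the \<open>k\<close>-dimensional cost in units of \<open>\<delta> ^ k\<close>.
\<close>

definition scale_cover :: "real \<Rightarrow> nat \<Rightarrow> 'a::metric_space set \<Rightarrow> nat \<Rightarrow> bool" where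
  "scale_cover \<delta> K B v \<longleftrightarrow>
     (\<exists>cs. B \<subseteq> (\<Union>(C, m)\<in>set cs. C) \<and>
           (\<forall>(C, m)\<in>set cs. \<forall>x\<in>C. \<forall>y\<in>C. dist x y \<le> \<delta> * 3 ^ m) \<and>
           (\<Sum>(C, m)\<leftarrow>cs. K ^ m) \<le> v)"

text \<open>The same \<open>v\<close> plays both roles of a max-flow min-cut pair: it is attained by
  an enumeration and suffices to pay for a cover. The case \<open>j = 0\<close> forces points at
  distance at most \<open>\<delta>\<close> to share a number.\<close>

definition holder_enumerable :: "real \<Rightarrow> nat \<Rightarrow> nat \<Rightarrow> 'a::metric_space set \<Rightarrow> nat \<Rightarrow> bool" where
  "holder_enumerable \<delta> K m B v \<longleftrightarrow> scale_cover \<delta> K B v \<and>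
     (\<exists>g. g ` B = {..<v} \<and>
          (\<forall>x\<in>B. \<forall>y\<in>B. \<forall>j\<le>m. dist x y \<le> \<delta> * 3 ^ j \<longrightarrow> \<bar>real (g x) - real (g y)\<bar> < real K ^ j))"

lemma scale_coverE:
  assumes "scale_cover \<delta> K B v"
  obtains cs where "B \<subseteq> (\<Union>(C, m)\<in>set cs. C)"
    "\<forall>(C, m)\<in>set cs. \<forall>x\<in>C. \<forall>y\<in>C. dist x y \<le> \<delta> * 3 ^ m"
    "(\<Sum>(C, m)\<leftarrow>cs. K ^ m) \<le> v"
  using assms unfolding scale_cover_def by (elim exE conjE)

lemma holder_enumerableE:
  assumes "holder_enumerable \<delta> K m B v"
  obtains g where "g ` B = {..<v}"
    "\<forall>x\<in>B. \<forall>y\<in>B. \<forall>j\<le>m. dist x y \<le> \<delta> * 3 ^ j \<longrightarrow> \<bar>real (g x) - real (g y)\<bar> < real K ^ j"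
  using assms unfolding holder_enumerable_def by (elim exE conjE)

lemma scale_cover_Un:
  assumes "scale_cover \<delta> K B v" "scale_cover \<delta> K B' v'"
  shows "scale_cover \<delta> K (B \<union> B') (v + v')"
proof -
  obtain cs where cs: "B \<subseteq> (\<Union>(C, m)\<in>set cs. C)"
    "\<forall>(C, m)\<in>set cs. \<forall>x\<in>C. \<forall>y\<in>C. dist x y \<le> \<delta> * 3 ^ m"
    "(\<Sum>(C, m)\<leftarrow>cs. K ^ m) \<le> v"
    using assms(1) by (rule scale_coverE)
  obtain cs' where cs': "B' \<subseteq> (\<Union>(C, m)\<in>set cs'. C)"
    "\<forall>(C, m)\<in>set cs'. \<forall>x\<in>C. \<forall>y\<in>C. dist x y \<le> \<delta> * 3 ^ m"
    "(\<Sum>(C, m)\<leftarrow>cs'. K ^ m) \<le> v'"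
    using assms(2) by (rule scale_coverE)
  show ?thesis unfolding scale_cover_def
  proof (intro exI[of _ "cs @ cs'"] conjI)
    show "B \<union> B' \<subseteq> (\<Union>(C, m)\<in>set (cs @ cs'). C)"
      using cs(1) cs'(1) unfolding set_append UN_Un by (rule Un_mono)
    show "\<forall>(C, m)\<in>set (cs @ cs'). \<forall>x\<in>C. \<forall>y\<in>C. dist x y \<le> \<delta> * 3 ^ m"
      using cs(2) cs'(2) unfolding set_append ball_Un by (rule conjI)
    show "(\<Sum>(C, m)\<leftarrow>cs @ cs'. K ^ m) \<le> v + v'" using cs(3) cs'(3) by simp
  qed
qed

lemma scale_cover_single:
  assumes "\<And>x y. x \<in> B \<Longrightarrow> y \<in> B \<Longrightarrow> dist x y \<le> \<delta> * 3 ^ m"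
  shows "scale_cover \<delta> K B (K ^ m)"
  unfolding scale_cover_def using assms by (intro exI[of _ "[(B, m)]"]) auto

lemma holder_enumerable_empty: "holder_enumerable \<delta> K m {} 0"
  unfolding holder_enumerable_def scale_cover_def by (auto intro: exI[of _ "[]"])

text \<open>Concatenation: the second enumeration is shifted by \<open>v\<close>. Points of
  different pieces are too far apart for any condition at a scale \<open>j \<le> m\<close>, so
  nothing has to be checked across the pieces.\<close>

lemma holder_enumerable_Un:
  assumes U: "holder_enumerable \<delta> K m B v" and U': "holder_enumerable \<delta> K m B' v'" and "\<delta> > 0"
    and sep: "\<And>x y. x \<in> B \<Longrightarrow> y \<in> B' \<Longrightarrow> dist x y > \<delta> * 3 ^ m"
  shows "holder_enumerable \<delta> K m (B \<union> B') (v + v')"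
proof -
  obtain g where g: "g ` B = {..<v}"
    "\<forall>x\<in>B. \<forall>y\<in>B. \<forall>j\<le>m. dist x y \<le> \<delta> * 3 ^ j \<longrightarrow> \<bar>real (g x) - real (g y)\<bar> < real K ^ j"
    using U by (rule holder_enumerableE)
  obtain g' where g': "g' ` B' = {..<v'}"
    "\<forall>x\<in>B'. \<forall>y\<in>B'. \<forall>j\<le>m. dist x y \<le> \<delta> * 3 ^ j \<longrightarrow> \<bar>real (g' x) - real (g' y)\<bar> < real K ^ j"
    using U' by (rule holder_enumerableE)
  define h where "h x = (if x \<in> B then g x else v + g' x)" for x
  \<comment> \<open>A common point would have positive distance to itself by
    \<open>sep\<close>.\<close>
  have disj: "x \<notin> B" if "x \<in> B'" for x
    using sep[of x x] that mult_pos_pos[OF \<open>\<delta> > 0\<close>, of "3 ^ m"] by fastforce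
  have far: "\<not> dist x y \<le> \<delta> * 3 ^ j" "\<not> dist y x \<le> \<delta> * 3 ^ j"
    if "x \<in> B" "y \<in> B'" "j \<le> m" for x y j
  proof -
    have "\<delta> * 3 ^ j \<le> \<delta> * 3 ^ m" using that \<open>\<delta> > 0\<close> by (intro mult_left_mono power_increasing) auto
    then show "\<not> dist x y \<le> \<delta> * 3 ^ j" "\<not> dist y x \<le> \<delta> * 3 ^ j"
      using sep[OF that(1,2)] by (simp_all add: dist_commute)
  qed
  have "h ` B' = (+) v ` (g' ` B')" using disj by (auto simp: h_def image_iff)
  also have "\<dots> = {v..<v + v'}" unfolding g' lessThan_atLeast0 by (simp add: add.commute)
  finally have "h ` (B \<union> B') = {..<v} \<union> {v..<v + v'}"
    using g(1) unfolding image_Un by (auto simp: h_def)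
  then have "h ` (B \<union> B') = {..<v + v'}" by auto
  moreover have "\<bar>real (h x) - real (h y)\<bar> < real K ^ j"
    if "x \<in> B \<union> B'" "y \<in> B \<union> B'" "j \<le> m" "dist x y \<le> \<delta> * 3 ^ j" for x y j
    using that far[of _ _ j] g(2)[rule_format, of x y j] g'(2)[rule_format, of x y j] disj[of x] disj[of y]
    by (auto simp: h_def)
  moreover have "scale_cover \<delta> K (B \<union> B') (v + v')"
    using U U' unfolding holder_enumerable_def by (intro scale_cover_Un) auto
  ultimately show ?thesis
    unfolding holder_enumerable_def by (intro conjI exI[of _ h] ballI allI impI)
qed

lemma holder_enumerable_Union:
  assumes "finite \<F>" "\<delta> > 0" "\<And>C. C \<in> \<F> \<Longrightarrow> \<exists>v. holder_enumerable \<delta> K m C v"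
    and sep: "\<And>C C' x y. C \<in> \<F> \<Longrightarrow> C' \<in> \<F> \<Longrightarrow> C \<noteq> C' \<Longrightarrow> x \<in> C \<Longrightarrow> y \<in> C' \<Longrightarrow> dist x y > \<delta> * 3 ^ m"
  shows "\<exists>v. holder_enumerable \<delta> K m (\<Union>\<F>) v"
  using assms(1,3) sep
proof (induction \<F> rule: finite_induct)
  case empty
  then show ?case using holder_enumerable_empty by auto
next
  case (insert C \<F>)
  have "\<exists>v. holder_enumerable \<delta> K m (\<Union>\<F>) v"
    by (rule insert.IH) (use insert.prems in blast)+
  then obtain v where v: "holder_enumerable \<delta> K m (\<Union>\<F>) v" by blast
  obtain w where w: "holder_enumerable \<delta> K m C w" using insert.prems(1) by blast
  have "dist x y > \<delta> * 3 ^ m" if "x \<in> C" "y \<in> \<Union>\<F>" for x y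
    using that insert.prems(2)[of C] insert.hyps(2) by blast
  from holder_enumerable_Un[OF w v \<open>\<delta> > 0\<close> this] show ?case by auto
qed

text \<open>Truncating the enumeration does not increase differences, so the old scales survive, and
  it makes the condition at scale \<open>Suc m\<close> automatic. When it lowers \<open>v\<close>,
  the set \<open>B\<close> alone is a cover of cost \<open>K ^ Suc m\<close>.\<close>

lemma holder_enumerable_cap:
  assumes U: "holder_enumerable \<delta> K m B v" and "K > 0"
    and diam: "\<And>x y. x \<in> B \<Longrightarrow> y \<in> B \<Longrightarrow> dist x y \<le> \<delta> * 3 ^ Suc m"
  shows "holder_enumerable \<delta> K (Suc m) B (min v (K ^ Suc m))"
proof -
  let ?M = "K ^ Suc m"
  obtain g where g: "g ` B = {..<v}"
    "\<forall>x\<in>B. \<forall>y\<in>B. \<forall>j\<le>m. dist x y \<le> \<delta> * 3 ^ j \<longrightarrow> \<bar>real (g x) - real (g y)\<bar> < real K ^ j"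
    using U by (rule holder_enumerableE)
  define h where "h x = min (g x) (?M - 1)" for x
  have M: "?M > 0" using \<open>K > 0\<close> by simp
  have "h ` B = (\<lambda>i. min i (?M - 1)) ` {..<v}" unfolding g(1)[symmetric] h_def by auto
  also have "\<dots> = {..<min v ?M}"
  proof
    show "(\<lambda>i. min i (?M - 1)) ` {..<v} \<subseteq> {..<min v ?M}"
      using M by (auto simp del: power_Suc simp: min_less_iff_disj)
    show "{..<min v ?M} \<subseteq> (\<lambda>i. min i (?M - 1)) ` {..<v}"
    proof
      fix i assume "i \<in> {..<min v ?M}"
      then show "i \<in> (\<lambda>i. min i (?M - 1)) ` {..<v}" by (intro image_eqI[of _ _ i]) auto
    qed
  qed
  finally have h: "h ` B = {..<min v ?M}" .
  have "\<bar>real (h x) - real (h y)\<bar> < real K ^ j"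
    if "x \<in> B" "y \<in> B" "j \<le> Suc m" "dist x y \<le> \<delta> * 3 ^ j" for x y j
  proof (cases "j \<le> m")
    case True
    have "\<bar>real (h x) - real (h y)\<bar> \<le> \<bar>real (g x) - real (g y)\<bar>"
      unfolding h_def by linarith
    then show ?thesis using g(2)[rule_format, of x y j] that True by linarith
  next
    case False
    then have "j = Suc m" using that by simp
    moreover have "h x < ?M" "h y < ?M" using h that by auto
    then have "real (h x) < real ?M" "real (h y) < real ?M" by (simp_all only: of_nat_less_iff)
    then have "\<bar>real (h x) - real (h y)\<bar> < real ?M" by linarith
    ultimately show ?thesis by simp
  qed
  moreover have "scale_cover \<delta> K B (min v ?M)"
    using U scale_cover_single[OF diam, where K = K] unfolding holder_enumerable_def min_def by auto
  ultimately show ?thesis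
    using h unfolding holder_enumerable_def by (intro conjI exI[of _ h] ballI allI impI)
qed

text \<open>In an ultrametric space, being at distance at most \<open>\<delta> * 3 ^ m\<close> is an
  equivalence relation. Compactness leaves finitely many classes, and points of different classes
  are farther apart than that, so enumerations of the classes can be concatenated.\<close>

lemma holder_enumerable_if_classes:
  fixes X :: "'a::metric_space set"
  assumes "compact X" "ultrametric_on X" "\<delta> > 0" "B \<subseteq> X"
    and cl: "\<And>C. C \<subseteq> X \<Longrightarrow> (\<And>x y. x \<in> C \<Longrightarrow> y \<in> C \<Longrightarrow> dist x y \<le> \<delta> * 3 ^ m)
                \<Longrightarrow> \<exists>v. holder_enumerable \<delta> K m C v"
  shows "\<exists>v. holder_enumerable \<delta> K m B v"
proof -
  define r where "r = \<delta> * 3 ^ m"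
  have r: "r > 0" using \<open>\<delta> > 0\<close> by (simp add: r_def)
  have um: "dist x y \<le> r" if "x \<in> X" "y \<in> X" "z \<in> X" "dist x z \<le> r" "dist y z \<le> r" for x y z
    using \<open>ultrametric_on X\<close> that unfolding ultrametric_on_def by (meson max.bounded_iff order_trans)
  obtain T where T: "T \<subseteq> X" "finite T" "X \<subseteq> (\<Union>c\<in>T. ball c r)"
    by (rule compactE_image[OF \<open>compact X\<close>, of X "\<lambda>x. ball x r"]) (use r in auto)
  \<comment> \<open>The centres come from \<open>X\<close> and may lie outside \<open>B\<close>.
    Several centres may give the same class, hence the passage to the set of all \<open>P c\<close>
    and the proof below that different members are separated.\<close>
  define P where "P c = {y \<in> B. dist c y \<le> r}" for c
  have "\<exists>v. holder_enumerable \<delta> K m (\<Union>(P ` T)) v"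
  proof (rule holder_enumerable_Union)
    show "finite (P ` T)" using T by simp
    fix C assume "C \<in> P ` T"
    then obtain c where c: "c \<in> T" "C = P c" by auto
    show "\<exists>v. holder_enumerable \<delta> K m C v"
    proof (rule cl)
      show "C \<subseteq> X" using c \<open>B \<subseteq> X\<close> by (auto simp: P_def)
      fix x y assume "x \<in> C" "y \<in> C"
      then show "dist x y \<le> \<delta> * 3 ^ m"
        using um[of x y c] c T \<open>B \<subseteq> X\<close> by (auto simp: P_def r_def dist_commute)
    qed
  next
    fix C C' x y assume A: "C \<in> P ` T" "C' \<in> P ` T" "C \<noteq> C'" "x \<in> C" "y \<in> C'"
    then obtain c c' where c: "c \<in> T" "C = P c" "c' \<in> T" "C' = P c'" by auto
    have X: "c \<in> X" "c' \<in> X" "x \<in> X" "y \<in> X" using A c T \<open>B \<subseteq> X\<close> by (auto simp: P_def)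
    show "\<delta> * 3 ^ m < dist x y"
    proof (rule ccontr)
      assume "\<not> \<delta> * 3 ^ m < dist x y"
      then have xy: "dist x y \<le> r" by (simp add: r_def)
      have "dist c x \<le> r" "dist c' y \<le> r" using A c by (auto simp: P_def)
      then have "dist c c' \<le> r" using um X xy by (metis dist_commute)
      then have "C = C'" unfolding c P_def using um X \<open>B \<subseteq> X\<close>
        by (intro Collect_cong) (metis dist_commute subsetD)
      then show False using A by blast
    qed
  qed (fact \<open>\<delta> > 0\<close>)
  moreover have "\<Union>(P ` T) = B"
    using T(3) \<open>B \<subseteq> X\<close> by (force simp: P_def)
  ultimately show ?thesis by simp
qed

text \<open>Induction up the tree of balls: a nonempty class at scale 0 gets the single number 0; a
  class at scale \<open>Suc m\<close> is first enumerated at scale \<open>m\<close> by its children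
  and then truncated.\<close>

lemma holder_enumerable_exists:
  fixes X :: "'a::metric_space set"
  assumes "compact X" "ultrametric_on X" "\<delta> > 0" "B \<subseteq> X" "K > 0"
  shows "\<exists>v. holder_enumerable \<delta> K m B v"
  using assms(4)
proof (induction m arbitrary: B)
  case 0
  show ?case
  proof (rule holder_enumerable_if_classes[OF assms(1-3) 0])
    fix C assume C: "C \<subseteq> X" "\<And>x y. x \<in> C \<Longrightarrow> y \<in> C \<Longrightarrow> dist x y \<le> \<delta> * 3 ^ 0"
    show "\<exists>v. holder_enumerable \<delta> K 0 C v"
    proof (cases "C = {}")
      case True
      then show ?thesis using holder_enumerable_empty by auto
    next
      case False
      then have "holder_enumerable \<delta> K 0 C 1"
        using scale_cover_single[OF C(2), where K = K] unfolding holder_enumerable_def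
        by (auto intro!: exI[of _ "\<lambda>_. 0"])
      then show ?thesis by blast
    qed
  qed
next
  case (Suc m)
  show ?case
  proof (rule holder_enumerable_if_classes[OF assms(1-3) Suc.prems])
    fix C assume C: "C \<subseteq> X" "\<And>x y. x \<in> C \<Longrightarrow> y \<in> C \<Longrightarrow> dist x y \<le> \<delta> * 3 ^ Suc m"
    then show "\<exists>v. holder_enumerable \<delta> K (Suc m) C v"
      using Suc.IH holder_enumerable_cap[OF _ \<open>K > 0\<close> C(2)] by blast
  qed
qed

text \<open>A cover of cost \<open>v\<close> has \<open>k\<close>-dimensional cost at most
  \<open>v * \<delta> ^ k\<close>. If this is below \<open>\<delta>0 ^ k\<close>, every single set
  has diameter at most \<open>\<delta>0\<close>, so the cover is admissible for the content at scale
  \<open>\<delta>0\<close> and cannot cost less than \<open>a\<close>. Hence the minimum of the two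
  bounds.\<close>

lemma scale_cover_lower_bound:
  fixes X :: "'a::metric_space set"
  assumes pos: "hausdorff_measure (real k) X > 0"
  obtains \<eta> where "\<eta> > 0" "\<And>\<delta> v. \<delta> > 0 \<Longrightarrow> scale_cover \<delta> (3 ^ k) X v \<Longrightarrow> \<eta> \<le> real v * \<delta> ^ k"
proof -
  obtain \<delta>0 where \<delta>0: "\<delta>0 > 0" "hausdorff_content (real k) \<delta>0 X > 0"
    using pos unfolding hausdorff_measure_def less_SUP_iff by auto
  \<comment> \<open>The content may be infinite, so a finite positive value below it is
    taken.\<close>
  obtain b where b: "0 < b" "b < hausdorff_content (real k) \<delta>0 X" using dense[OF \<delta>0(2)] by blast
  then obtain a where a: "a > 0" "b = ennreal a"
    by (cases b) auto
  show thesis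
  proof (rule that[of "min a (\<delta>0 ^ k)"])
    show "min a (\<delta>0 ^ k) > 0" using a \<delta>0 by simp
    fix \<delta> :: real and v assume "\<delta> > 0" "scale_cover \<delta> (3 ^ k) X v"
    then obtain cs where cs: "X \<subseteq> (\<Union>(C, m)\<in>set cs. C)"
      "\<forall>(C, m)\<in>set cs. \<forall>x\<in>C. \<forall>y\<in>C. dist x y \<le> \<delta> * 3 ^ m"
      "(\<Sum>(C, m)\<leftarrow>cs. (3 ^ k) ^ m) \<le> v"
      by (elim scale_coverE)
    show "min a (\<delta>0 ^ k) \<le> real v * \<delta> ^ k"
    proof (rule ccontr)
      assume "\<not> min a (\<delta>0 ^ k) \<le> real v * \<delta> ^ k"
      then have small: "real v * \<delta> ^ k < a" "real v * \<delta> ^ k < \<delta>0 ^ k" by auto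
      define n where "n = length cs"
      define s where "s i = \<delta> * 3 ^ snd (cs ! i)" for i
      \<comment> \<open>Padding by empty sets, of diameter 0, turns the finite list into a sequence
        at no cost.\<close>
      define C where "C i = (if i < n then fst (cs ! i) else {})" for i
      have s0: "s i > 0" for i using \<open>\<delta> > 0\<close> by (simp add: s_def)
      have dC: "dist x y \<le> s i" if "x \<in> C i" "y \<in> C i" for x y i
        using cs(2)[rule_format, of "cs ! i"] that
        by (auto simp: C_def s_def n_def case_prod_unfold split: if_splits)
      have bd: "bounded (C i)" for i
        unfolding bounded_two_points by (intro exI[of _ "s i"] ballI dC)
      have diam: "diameter (C i) \<le> s i" for i
      proof (cases "C i = {}")
        case False
        have "(SUP (x, y)\<in>C i \<times> C i. dist x y) \<le> s i"
          by (rule cSUP_least) (use False dC in auto)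
        then show ?thesis using False by (simp add: diameter_def)
      qed (simp add: less_imp_le[OF s0])
      have sumv: "(\<Sum>i<n. s i ^ k) \<le> real v * \<delta> ^ k"
      proof -
        have "(\<Sum>i<n. s i ^ k) = real (\<Sum>i<n. (3 ^ k) ^ snd (cs ! i)) * \<delta> ^ k"
          unfolding s_def of_nat_sum sum_distrib_right
          by (intro sum.cong refl) (simp add: power_mult_distrib mult.commute flip: power_mult)
        also have "(\<Sum>i<n. (3 ^ k) ^ snd (cs ! i)) = (\<Sum>(C, m)\<leftarrow>cs. (3 ^ k) ^ m)"
          by (simp add: sum_list_sum_nth n_def case_prod_unfold lessThan_atLeast0)
        also have "real \<dots> * \<delta> ^ k \<le> real v * \<delta> ^ k"
          using cs(3) \<open>\<delta> > 0\<close> by (intro mult_right_mono) (auto simp only: of_nat_le_iff zero_le_power less_imp_le)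
        finally show ?thesis .
      qed
      have "diameter (C i) \<le> \<delta>0" for i
      proof (cases "i < n")
        case True
        then have "s i ^ k \<le> (\<Sum>i<n. s i ^ k)"
          using s0 by (intro member_le_sum) (auto intro: less_imp_le)
        then have "s i ^ k < \<delta>0 ^ k" using sumv small by linarith
        then have "s i < \<delta>0" by (rule power_less_imp_less_base) (use \<delta>0(1) in simp)
        then show ?thesis using diam[of i] by linarith
      next
        case False
        then show ?thesis using \<delta>0 by (simp add: C_def)
      qed
      moreover have "X \<subseteq> (\<Union>i. C i)"
      proof
        fix x assume "x \<in> X"
        then have "x \<in> (\<Union>c\<in>set cs. fst c)" using cs(1) by (auto simp: case_prod_unfold)
        then obtain i where "i < length cs" "x \<in> fst (cs ! i)"
          by (auto simp: in_set_conv_nth)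
        then have "x \<in> C i" by (simp add: C_def n_def)
        then show "x \<in> (\<Union>i. C i)" by blast
      qed
      ultimately have "hausdorff_content (real k) \<delta>0 X \<le> (\<Sum>i. ennreal (diameter (C i) powr real k))"
        unfolding hausdorff_content_def using bd by (intro INF_lower) auto
      also have "\<dots> = (\<Sum>i<n. ennreal (diameter (C i) powr real k))"
        by (intro suminf_finite) (auto simp: C_def)
      also have "\<dots> \<le> (\<Sum>i<n. ennreal (s i ^ k))"
      proof (intro sum_mono ennreal_leI)
        fix i
        have "diameter (C i) powr real k \<le> s i powr real k"
          using diam diameter_ge_0[OF bd] by (intro powr_mono2) auto
        then show "diameter (C i) powr real k \<le> s i ^ k" using s0 by (simp add: powr_realpow)
      qed
      also have "\<dots> = ennreal (\<Sum>i<n. s i ^ k)"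
        using s0 by (intro sum_ennreal) (auto intro: less_imp_le)
      also have "\<dots> \<le> ennreal a" using sumv small by (intro ennreal_leI) linarith
      finally show False using b a by auto
    qed
  qed
qed

section \<open>Limits of Lipschitz maps\<close>

lemma compact_countable_dense:
  fixes X :: "'a::metric_space set"
  assumes "compact X"
  obtains D where "countable D" "D \<subseteq> X" "\<And>x e. x \<in> X \<Longrightarrow> e > 0 \<Longrightarrow> \<exists>y\<in>D. dist x y < e"
proof -
  have "\<exists>T. T \<subseteq> X \<and> finite T \<and> X \<subseteq> (\<Union>c\<in>T. ball c (1 / Suc n))" for n
    using compactE_image[OF assms, of X "\<lambda>x. ball x (1 / Suc n)"]
    by (metis UN_I centre_in_ball divide_pos_pos of_nat_0_less_iff open_ball subsetI zero_less_Suc zero_less_one)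
  then obtain T where T: "\<And>n. T n \<subseteq> X" "\<And>n. finite (T n)"
      "\<And>n. X \<subseteq> (\<Union>c\<in>T n. ball c (1 / Suc n))"
    by metis
  show thesis
  proof (rule that[of "\<Union>n. T n"])
    show "countable (\<Union>n. T n)" using T(2) by (simp add: countable_finite)
    show "(\<Union>n. T n) \<subseteq> X" using T(1) by blast
    fix x and e :: real assume x: "x \<in> X" "e > 0"
    obtain n where n: "1 / real (Suc n) < e" using nat_approx_posE[OF \<open>e > 0\<close>] by blast
    obtain y where "y \<in> T n" "dist y x < 1 / Suc n" using T(3)[of n] x(1) by auto
    then show "\<exists>y\<in>\<Union>n. T n. dist x y < e" using n by (metis UN_I UNIV_I dist_commute less_trans)
  qed
qed

text \<open>An Arzela-Ascoli argument: a diagonal subsequence converges on a countable dense set,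
  hence on \<open>X\<close> by the common Lipschitz constant. Surjectivity passes to the limit
  because approximate preimages of a point accumulate in the compact \<open>X\<close>.\<close>

lemma lipschitz_limit_onto_cube:
  fixes F :: "nat \<Rightarrow> 'a::metric_space \<Rightarrow> nat \<Rightarrow> real"
  assumes "compact X"
    and lip: "\<And>n x y l. x \<in> X \<Longrightarrow> y \<in> X \<Longrightarrow> l < k \<Longrightarrow> \<bar>F n x l - F n y l\<bar> \<le> L * dist x y"
    and rng: "\<And>n x l. x \<in> X \<Longrightarrow> l < k \<Longrightarrow> F n x l \<in> {0..1}"
    and dense: "\<And>n p. p \<in> unit_cube k \<Longrightarrow> \<exists>x\<in>X. \<forall>l<k. \<bar>F n x l - p l\<bar> \<le> e n"
    and e: "e \<longlonglongrightarrow> 0"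
  shows "\<exists>f. (\<exists>L. \<forall>x\<in>X. \<forall>y\<in>X. euclid_dist k (f x) (f y) \<le> L * dist x y) \<and> f ` X = unit_cube k"
proof -
  define M where "M = max L 1"
  have M: "M > 0" by (simp add: M_def)
  have lipM: "\<bar>F n x l - F n y l\<bar> \<le> M * dist x y" if "x \<in> X" "y \<in> X" "l < k" for n x y l
  proof -
    have "L * dist x y \<le> M * dist x y" by (intro mult_right_mono) (auto simp: M_def)
    then show ?thesis using lip[OF that, of n] by linarith
  qed
  obtain D where D: "countable D" "D \<subseteq> X" "\<And>x e. x \<in> X \<Longrightarrow> e > 0 \<Longrightarrow> \<exists>y\<in>D. dist x y < e"
    using compact_countable_dense[OF \<open>compact X\<close>] by blast
  have cnt: "countable (D \<times> {..<k})" using D(1) by auto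
  have bdd: "norm (case z of (x, l) \<Rightarrow> F n x l) \<le> 1" if "z \<in> D \<times> {..<k}" for n z
    using that rng D(2) by fastforce
  obtain r :: "nat \<Rightarrow> nat" where r: "strict_mono r"
    and r': "\<And>z. z \<in> D \<times> {..<k} \<Longrightarrow> \<exists>a. (\<lambda>n. case z of (x, l) \<Rightarrow> F (r n) x l) \<longlonglongrightarrow> a"
    by (rule function_convergent_subsequence[OF cnt, of "\<lambda>n z. case z of (x, l) \<Rightarrow> F n x l" 1])
       (use bdd in auto)
  have "Cauchy (\<lambda>n. F (r n) x l)" if x: "x \<in> X" "l < k" for x l
  proof (rule metric_CauchyI)
    fix \<epsilon> :: real assume "\<epsilon> > 0"
    then obtain y where y: "y \<in> D" "dist x y < \<epsilon> / (3 * M)"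
      using D(3)[OF x(1), of "\<epsilon> / (3 * M)"] M by auto
    have "Cauchy (\<lambda>n. F (r n) y l)" using r'[of "(y, l)"] y x by (auto intro: LIMSEQ_imp_Cauchy)
    from metric_CauchyD[OF this, of "\<epsilon> / 3"]
    obtain N where N: "\<forall>m\<ge>N. \<forall>n\<ge>N. dist (F (r m) y l) (F (r n) y l) < \<epsilon> / 3"
      using \<open>\<epsilon> > 0\<close> by auto
    have d: "\<bar>F n x l - F n y l\<bar> < \<epsilon> / 3" for n
    proof -
      have "M * dist x y < M * (\<epsilon> / (3 * M))" using y M by (intro mult_strict_left_mono)
      also have "\<dots> = \<epsilon> / 3" using M by simp
      finally show ?thesis using lipM[of x y l n] x y D(2) by fastforce
    qed
    show "\<exists>N. \<forall>m\<ge>N. \<forall>n\<ge>N. dist (F (r m) x l) (F (r n) x l) < \<epsilon>"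
    proof (intro exI[of _ N] allI impI)
      fix m n assume "m \<ge> N" "n \<ge> N"
      then show "dist (F (r m) x l) (F (r n) x l) < \<epsilon>"
        using N[rule_format, of m n] d[of "r m"] d[of "r n"] unfolding dist_real_def by linarith
    qed
  qed
  then have "\<exists>a. (\<lambda>n. F (r n) x l) \<longlonglongrightarrow> a" if "x \<in> X" "l < k" for x l
    using that Cauchy_convergent_iff convergent_def by blast
  then obtain G where G: "\<And>x l. x \<in> X \<Longrightarrow> l < k \<Longrightarrow> (\<lambda>n. F (r n) x l) \<longlonglongrightarrow> G x l"
    by metis
  have lipG: "\<bar>G x l - G y l\<bar> \<le> M * dist x y" if "x \<in> X" "y \<in> X" "l < k" for x y l
  proof (rule LIMSEQ_le_const2)
    show "(\<lambda>n. \<bar>F (r n) x l - F (r n) y l\<bar>) \<longlonglongrightarrow> \<bar>G x l - G y l\<bar>"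
      by (intro tendsto_intros G that)
  qed (use lipM that in blast)
  have rngG: "G x l \<in> {0..1}" if "x \<in> X" "l < k" for x l
    using LIMSEQ_le_const[OF G[OF that]] LIMSEQ_le_const2[OF G[OF that]] rng that by auto
  \<comment> \<open>The points of \<open>unit_cube k\<close> are extensional, whereas
    \<open>G x\<close> is arbitrary beyond \<open>k\<close>.\<close>
  define f where "f x = restrict (G x) {..<k}" for x
  have "euclid_dist k (f x) (f y) \<le> (real k * M) * dist x y" if "x \<in> X" "y \<in> X" for x y
  proof -
    have "euclid_dist k (f x) (f y) \<le> (\<Sum>i<k. \<bar>f x i - f y i\<bar>)"
      unfolding euclid_dist_def by (rule L2_set_le_sum_abs)
    also have "\<dots> \<le> (\<Sum>i<k. M * dist x y)"
      by (intro sum_mono) (use lipG that in \<open>auto simp: f_def\<close>)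
    finally show ?thesis by simp
  qed
  moreover have "f ` X = unit_cube k"
  proof
    show "f ` X \<subseteq> unit_cube k"
      unfolding f_def unit_cube_def by (intro image_subsetI) (simp add: restrict_PiE_iff rngG del: atLeastAtMost_iff)
    show "unit_cube k \<subseteq> f ` X"
    proof
      fix p assume p: "p \<in> unit_cube k"
      obtain u where u: "\<And>n. u n \<in> X" "\<And>n l. l < k \<Longrightarrow> \<bar>F n (u n) l - p l\<bar> \<le> e n"
        using dense[OF p] by metis
      obtain x s where x: "x \<in> X" and s: "strict_mono (s :: nat \<Rightarrow> nat)"
        and lim: "(\<lambda>n. u (r (s n))) \<longlonglongrightarrow> x"
        using \<open>compact X\<close>[unfolded compact_def, rule_format, of "\<lambda>n. u (r n)"] u(1)
        by (auto simp: o_def)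
      have "G x l = p l" if "l < k" for l
      proof -
        have 1: "(\<lambda>n. F (r (s n)) x l) \<longlonglongrightarrow> G x l"
          using LIMSEQ_subseq_LIMSEQ[OF G[OF x that] s] by (simp add: o_def)
        have "(\<lambda>n. e (r (s n))) \<longlonglongrightarrow> 0"
          using LIMSEQ_subseq_LIMSEQ[OF e strict_mono_o[OF r s]] by (simp add: o_def)
        \<comment> \<open>The two terms are the price of moving from \<open>x\<close> to the
          approximate preimage and the error of that preimage.\<close>
        then have 2: "(\<lambda>n. M * dist x (u (r (s n))) + e (r (s n))) \<longlonglongrightarrow> M * dist x x + 0"
          by (intro tendsto_intros lim)
        have "(\<lambda>n. F (r (s n)) x l - p l) \<longlonglongrightarrow> 0"
        proof (rule Lim_null_comparison)
          show "(\<lambda>n. M * dist x (u (r (s n))) + e (r (s n))) \<longlonglongrightarrow> 0" using 2 by simp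
          show "\<forall>\<^sub>F n in sequentially.
              norm (F (r (s n)) x l - p l) \<le> M * dist x (u (r (s n))) + e (r (s n))"
          proof (intro always_eventually allI)
            fix n
            show "norm (F (r (s n)) x l - p l) \<le> M * dist x (u (r (s n))) + e (r (s n))"
              using lipM[OF x u(1) that, of "r (s n)" "r (s n)"] u(2)[OF that, of "r (s n)"]
              unfolding real_norm_def by linarith
          qed
        qed
        then have "(\<lambda>n. F (r (s n)) x l) \<longlonglongrightarrow> p l" by (simp add: LIM_zero_iff)
        then show ?thesis using 1 LIMSEQ_unique by blast
      qed
      then have "f x l = p l" for l
        using PiE_arb[OF p[unfolded unit_cube_def], of l] by (simp add: f_def)
      then have "f x = p" by (rule ext)
      then show "p \<in> f ` X" using x by blast
    qed
  qed
  ultimately show ?thesis by blast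
qed

section \<open>Lipschitz maps onto the cube\<close>

text \<open>The enumeration, cut to \<open>3 ^ (k * n)\<close> values, is followed by the Peano
  curve. For the least \<open>j\<close> with \<open>dist x y \<le> \<delta> * 3 ^ j\<close> the
  exponents \<open>k\<close> and \<open>1/k\<close> cancel and leave \<open>2 * 3 ^ j\<close>;
  minimality gives \<open>dist x y > \<delta> * 3 ^ (j - 1)\<close> if \<open>j > 0\<close>, whence
  the constant 6.\<close>

lemma discrete_lipschitz_onto_grid:
  fixes X :: "'a::metric_space set"
  assumes "holder_enumerable \<delta> (3 ^ k) N X v" "\<delta> > 0" "v \<ge> 3 ^ (k * n)"
    and diam: "\<And>x y. x \<in> X \<Longrightarrow> y \<in> X \<Longrightarrow> dist x y \<le> \<delta> * 3 ^ N"
  obtains F :: "'a \<Rightarrow> nat \<Rightarrow> nat" where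
    "\<And>x y l. x \<in> X \<Longrightarrow> y \<in> X \<Longrightarrow> l < k \<Longrightarrow> \<bar>real (F x l) - real (F y l)\<bar> \<le> 6 / \<delta> * dist x y"
    "\<And>x l. l < k \<Longrightarrow> F x l < 3 ^ n"
    "\<And>z. (\<And>l. l < k \<Longrightarrow> z l < 3 ^ n) \<Longrightarrow> \<exists>x\<in>X. \<forall>l<k. F x l = z l"
proof -
  obtain g where g: "g ` X = {..<v}"
    "\<forall>x\<in>X. \<forall>y\<in>X. \<forall>j\<le>N. dist x y \<le> \<delta> * 3 ^ j
       \<longrightarrow> \<bar>real (g x) - real (g y)\<bar> < real (3 ^ k) ^ j"
    using assms(1) by (rule holder_enumerableE)
  define h where "h x = min (g x) (3 ^ (k * n) - 1)" for x
  have h_less: "h x < 3 ^ (k * n)" for x by (simp add: h_def min_less_iff_disj)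
  have h_onto: "\<exists>x\<in>X. h x = t" if "t < 3 ^ (k * n)" for t
  proof -
    have "t \<in> g ` X" using that assms(3) by (simp add: g)
    then obtain x where "x \<in> X" "g x = t" by blast
    then show ?thesis using that by (auto simp: h_def intro!: bexI[of _ x])
  qed
  define F where "F x l = peano_coord k (k * n) (h x) l" for x l
  show thesis
  proof (rule that[of F])
    show "F x l < 3 ^ n" if "l < k" for x l
      using peano_coord_less[of k "k * n" "h x" l] peano_digits_mult[OF that, of n] by (simp add: F_def)
    show "\<exists>x\<in>X. \<forall>l<k. F x l = z l" if "\<And>l. l < k \<Longrightarrow> z l < 3 ^ n" for z
    proof -
      have "\<exists>t<3 ^ (k * n). \<forall>l<k. peano_coord k (k * n) t l = z l"
        by (rule peano_coord_surj) (simp add: peano_digits_mult that)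
      then obtain t where "t < 3 ^ (k * n)" "\<forall>l<k. peano_coord k (k * n) t l = z l" by blast
      then show ?thesis using h_onto[of t] unfolding F_def by metis
    qed
    fix x y l assume xy: "x \<in> X" "y \<in> X" "l < k"
    have hg: "\<bar>real (h x) - real (h y)\<bar> \<le> \<bar>real (g x) - real (g y)\<bar>"
      unfolding h_def by linarith
    define j where "j = (LEAST j. dist x y \<le> \<delta> * 3 ^ j)"
    have j: "dist x y \<le> \<delta> * 3 ^ j" unfolding j_def using diam xy by (intro LeastI)
    have jN: "j \<le> N" unfolding j_def using diam xy by (intro Least_le)
    have gj: "\<bar>real (g x) - real (g y)\<bar> < real (3 ^ k) ^ j" using g(2) xy j jN by blast
    show "\<bar>real (F x l) - real (F y l)\<bar> \<le> 6 / \<delta> * dist x y"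
    proof (cases j)
      case 0
      then have "h x = h y" using gj hg by simp
      then show ?thesis using \<open>\<delta> > 0\<close> by (simp add: F_def)
    next
      case (Suc i)
      then have "\<not> dist x y \<le> \<delta> * 3 ^ i"
        using not_less_Least[of i "\<lambda>j. dist x y \<le> \<delta> * 3 ^ j"] unfolding j_def by simp
      then have "2 * 3 ^ j \<le> 6 / \<delta> * dist x y" using \<open>\<delta> > 0\<close> Suc by (simp add: field_simps)
      moreover have "\<bar>real (F x l) - real (F y l)\<bar> \<le> 2 * 3 ^ j"
        unfolding F_def using hg gj by (intro peano_coord_holder h_less \<open>l < k\<close>) simp
      ultimately show ?thesis by linarith
    qed
  qed
qed

text \<open>Rounds to the grid \<open>{..<M}\<close>; the cap handles the right end point
  \<open>q = M\<close>, whose floor lies outside the grid.\<close>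

lemma nat_floor_cap_approx:
  fixes q :: real
  assumes "0 \<le> q" "q \<le> real M" "M > 0"
  shows "\<bar>real (min (nat \<lfloor>q\<rfloor>) (M - 1)) - q\<bar> \<le> 1"
proof (cases "nat \<lfloor>q\<rfloor> \<le> M - 1")
  case True
  then show ?thesis using assms(1) by (simp add: min_absorb1) linarith
next
  case False
  then have "real M \<le> q" using assms by linarith
  then show ?thesis using False assms by (simp add: min_absorb2 of_nat_diff)
qed

lemma lipschitz_onto_cube_if_hausdorff_measure_pos:
  fixes X :: "'a::metric_space set"
  assumes "compact X" "ultrametric_on X" "k \<ge> 1" "hausdorff_measure (real k) X > 0"
  shows "\<exists>f. (\<exists>L. \<forall>x\<in>X. \<forall>y\<in>X. euclid_dist k (f x) (f y) \<le> L * dist x y) \<and> f ` X = unit_cube k"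
proof -
  obtain R0 where R0: "\<And>x y. x \<in> X \<Longrightarrow> y \<in> X \<Longrightarrow> dist x y \<le> R0"
    using compact_imp_bounded[OF \<open>compact X\<close>] unfolding bounded_two_points by blast
  define R where "R = max R0 1"
  have R: "R > 0" "\<And>x y. x \<in> X \<Longrightarrow> y \<in> X \<Longrightarrow> dist x y \<le> R"
    using R0 by (auto simp: R_def le_max_iff_disj)
  obtain \<eta> where \<eta>: "\<eta> > 0"
    "\<And>\<delta> v. \<delta> > 0 \<Longrightarrow> scale_cover \<delta> (3 ^ k) X v \<Longrightarrow> \<eta> \<le> real v * \<delta> ^ k"
    using scale_cover_lower_bound[OF assms(4)] by metis
  \<comment> \<open>\<open>s\<close> extra levels of subdivision, the same for all \<open>n\<close>,
    absorb the constant \<open>R ^ k / \<eta>\<close> and guarantee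
    \<open>v \<ge> 3 ^ (k * n)\<close>. Their price is the factor \<open>3 ^ s\<close> in the
    Lipschitz constant.\<close>
  obtain s where "R ^ k / \<eta> < 3 ^ s" using real_arch_pow[of 3 "R ^ k / \<eta>"] by auto
  also have "(3::real) ^ s \<le> 3 ^ (k * s)" using \<open>k \<ge> 1\<close> by (intro power_increasing) auto
  finally have s: "R ^ k \<le> \<eta> * 3 ^ (k * s)" using \<eta>(1) by (simp add: field_simps)
  have "\<exists>F :: 'a \<Rightarrow> nat \<Rightarrow> real.
      (\<forall>x\<in>X. \<forall>y\<in>X. \<forall>l<k. \<bar>F x l - F y l\<bar> \<le> 6 * 3 ^ s / R * dist x y) \<and>
      (\<forall>x\<in>X. \<forall>l<k. F x l \<in> {0..1}) \<and>
      (\<forall>p\<in>unit_cube k. \<exists>x\<in>X. \<forall>l<k. \<bar>F x l - p l\<bar> \<le> (1 / 3) ^ n)" for n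
  proof -
    define \<delta> where "\<delta> = R / 3 ^ (n + s)"
    have \<delta>: "\<delta> > 0" "\<delta> * 3 ^ (n + s) = R" using R by (simp_all add: \<delta>_def)
    obtain v where v: "holder_enumerable \<delta> (3 ^ k) (n + s) X v"
      using holder_enumerable_exists[OF assms(1,2) \<delta>(1) order_refl, of "3 ^ k"] by auto
    have "\<eta> \<le> real v * \<delta> ^ k" using \<eta>(2)[OF \<delta>(1)] v by (simp add: holder_enumerable_def)
    then have "\<eta> * 3 ^ (k * (n + s)) \<le> real v * \<delta> ^ k * 3 ^ (k * (n + s))"
      by (intro mult_right_mono) auto
    also have "\<dots> = real v * R ^ k"
      unfolding \<delta>(2)[symmetric] by (simp add: power_mult_distrib mult.commute flip: power_mult)
    finally have "\<eta> * 3 ^ (k * s) * 3 ^ (k * n) \<le> real v * R ^ k"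
      by (simp add: distrib_left power_add mult_ac)
    moreover have "3 ^ (k * n) * R ^ k \<le> \<eta> * 3 ^ (k * s) * 3 ^ (k * n)"
      using s by (simp add: mult.commute[of "3 ^ (k * n)"] mult_right_mono)
    ultimately have "3 ^ (k * n) * R ^ k \<le> real v * R ^ k" by linarith
    then have "real (3 ^ (k * n)) \<le> real v" using R by simp
    then have vn: "v \<ge> 3 ^ (k * n)" by (simp only: of_nat_le_iff)
    obtain F :: "'a \<Rightarrow> nat \<Rightarrow> nat" where F:
      "\<And>x y l. x \<in> X \<Longrightarrow> y \<in> X \<Longrightarrow> l < k \<Longrightarrow> \<bar>real (F x l) - real (F y l)\<bar> \<le> 6 / \<delta> * dist x y"
      "\<And>x l. l < k \<Longrightarrow> F x l < 3 ^ n"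
      "\<And>z. (\<And>l. l < k \<Longrightarrow> z l < 3 ^ n) \<Longrightarrow> \<exists>x\<in>X. \<forall>l<k. F x l = z l"
      by (rule discrete_lipschitz_onto_grid[OF v \<delta>(1) vn]) (use R(2) \<delta>(2) in auto)
    \<comment> \<open>Scaling the grid into the unit cube cancels the \<open>3 ^ n\<close> contained
      in \<open>6 / \<delta>\<close>, so the Lipschitz constant no longer depends on
      \<open>n\<close>.\<close>
    define G where "G x l = real (F x l) / 3 ^ n" for x l
    have "\<bar>G x l - G y l\<bar> \<le> 6 * 3 ^ s / R * dist x y" if "x \<in> X" "y \<in> X" "l < k" for x y l
    proof -
      have "\<bar>G x l - G y l\<bar> = \<bar>real (F x l) - real (F y l)\<bar> / 3 ^ n"
        unfolding G_def by (simp flip: diff_divide_distrib)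
      also have "\<dots> \<le> (6 / \<delta> * dist x y) / 3 ^ n" using F(1)[OF that] by (intro divide_right_mono) auto
      also have "\<dots> = 6 * 3 ^ s / R * dist x y" using R by (simp add: \<delta>_def power_add)
      finally show ?thesis .
    qed
    moreover have "G x l \<in> {0..1}" if "l < k" for x l
    proof -
      have "real (F x l) < real (3 ^ n)" using F(2)[OF that] by (simp only: of_nat_less_iff)
      then show ?thesis by (simp add: G_def)
    qed
    moreover have "\<exists>x\<in>X. \<forall>l<k. \<bar>G x l - p l\<bar> \<le> (1 / 3) ^ n" if p: "p \<in> unit_cube k" for p
    proof -
      define z where "z l = min (nat \<lfloor>p l * 3 ^ n\<rfloor>) (3 ^ n - 1)" for l
      have "z l < 3 ^ n" for l by (simp add: z_def min_less_iff_disj)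
      then obtain x where x: "x \<in> X" "\<And>l. l < k \<Longrightarrow> F x l = z l" using F(3) by metis
      have "\<bar>G x l - p l\<bar> \<le> (1 / 3) ^ n" if "l < k" for l
      proof -
        have "p l \<in> {0..1}"
          using PiE_mem[OF p[unfolded unit_cube_def], of l] that by simp
        then have "\<bar>real (z l) - p l * 3 ^ n\<bar> \<le> 1"
          unfolding z_def by (intro nat_floor_cap_approx) (simp_all add: mult_left_le_one_le)
        then have "\<bar>real (z l) - p l * 3 ^ n\<bar> / 3 ^ n \<le> 1 / 3 ^ n" by (intro divide_right_mono) auto
        moreover have "\<bar>real (z l) - p l * 3 ^ n\<bar> / 3 ^ n = \<bar>(real (z l) - p l * 3 ^ n) / 3 ^ n\<bar>" by simp
        ultimately show ?thesis by (simp add: G_def x that diff_divide_distrib power_one_over)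
      qed
      then show ?thesis using x(1) by blast
    qed
    ultimately show ?thesis by (intro exI[of _ G]) simp
  qed
  then obtain F :: "nat \<Rightarrow> 'a \<Rightarrow> nat \<Rightarrow> real" where F:
    "\<And>n. (\<forall>x\<in>X. \<forall>y\<in>X. \<forall>l<k. \<bar>F n x l - F n y l\<bar> \<le> 6 * 3 ^ s / R * dist x y) \<and>
      (\<forall>x\<in>X. \<forall>l<k. F n x l \<in> {0..1}) \<and>
      (\<forall>p\<in>unit_cube k. \<exists>x\<in>X. \<forall>l<k. \<bar>F n x l - p l\<bar> \<le> (1 / 3) ^ n)"
    by metis
  show ?thesis
  proof (rule lipschitz_limit_onto_cube[OF \<open>compact X\<close>,
        where F = F and L = "6 * 3 ^ s / R"])
    show "(\<lambda>n. (1 / 3 :: real) ^ n) \<longlonglongrightarrow> 0" by (intro LIMSEQ_power_zero) auto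
  qed (use F in simp_all)
qed

theorem theorem1p2:
  fixes X :: "'a::metric_space set" and k :: nat
  assumes "compact X" and "ultrametric_on X" and "k \<ge> 1"
  shows "(\<exists>f :: 'a \<Rightarrow> nat \<Rightarrow> real.
            (\<exists>L. \<forall>x\<in>X. \<forall>y\<in>X. euclid_dist k (f x) (f y) \<le> L * dist x y)
            \<and> f ` X = unit_cube k)
         \<longleftrightarrow> hausdorff_measure (real k) X > 0"
proof
  assume "\<exists>f :: 'a \<Rightarrow> nat \<Rightarrow> real.
            (\<exists>L. \<forall>x\<in>X. \<forall>y\<in>X. euclid_dist k (f x) (f y) \<le> L * dist x y) \<and> f ` X = unit_cube k"
  then obtain f :: "'a \<Rightarrow> nat \<Rightarrow> real" and L where
    "\<forall>x\<in>X. \<forall>y\<in>X. euclid_dist k (f x) (f y) \<le> L * dist x y" "f ` X = unit_cube k"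
    by (elim exE conjE)
  then show "hausdorff_measure (real k) X > 0"
    by (intro hausdorff_measure_pos_if_onto_cube[OF \<open>k \<ge> 1\<close>]) auto
next
  assume "hausdorff_measure (real k) X > 0"
  then show "\<exists>f :: 'a \<Rightarrow> nat \<Rightarrow> real.
            (\<exists>L. \<forall>x\<in>X. \<forall>y\<in>X. euclid_dist k (f x) (f y) \<le> L * dist x y) \<and> f ` X = unit_cube k"
    using assms by (intro lipschitz_onto_cube_if_hausdorff_measure_pos)
qed

end
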